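(* For every integer $c\ge2$, there is an oriented graph $H_c$ of order $N=7c-1$ with $\delta^0(H_c)=2c$ (so that $7\delta^0(H_c)=2N+2$) and distinct vertices $x,y$ of $H_c$ such that no directed path from $x$ to $y$ has length $3$, $4$, or $5$. Consequently, the statement "if an oriented graph $H$ of order $N$ has $d=\delta^0(H)\ge3$ and $7d\ge2N+2$, then every ordered pair of distinct vertices is joined by a directed path of length $3$, $4$, or $5$" is false. Moreover, there are no real constants $\gamma<21$ and $K$ such that the following holds for every positive integer $C$: whenever $H$ is an oriented graph of order $N\ge\gamma C+K$ with $\delta^0(H)\ge\frac N3-C+1$, every ordered pair of distinct vertices of $H$ is joined by a directed path of length $3$, $4$, or $5$.
   Context: An oriented graph is an orientation of a (finite) simple graph: no loops, and at most one arc on each unordered pair of vertices. $\delta^0(H)=\min_{v}\min\{d^+(v),d^-(v)\}$ is the minimum semidegree. Paths are directed and simple (no repeated vertices), and the length is the number of arcs. An ordered pair $(x,y)$ is joined by a path if there is a directed path from $x$ to $y$. *)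

theory Defs
  imports Complex_Main "Graph_Theory.Graph_Theory"
begin

text \<open>
  \<^locale>\<open>pair_digraph\<close> already gives finiteness, no loops, and (arcs being ordered pairs of
  vertices) no parallel arcs; an orientation of a simple graph additionally has no pair of
  opposite arcs.
\<close>

locale oriented_graph = pair_digraph +
  assumes no_opposite_arcs: "(u, v) \<in> parcs G \<Longrightarrow> (v, u) \<notin> parcs G"

text \<open>Only meaningful for finite graphs with at least one vertex, as \<^term>\<open>Min {}\<close> is unspecified.\<close>

definition min_semidegree :: "'a pair_pre_digraph \<Rightarrow> nat" where
  "min_semidegree H =
     Min ((\<lambda>v. min (out_degree (with_proj H) v) (in_degree (with_proj H) v)) ` pverts H)"

text \<open>
  A path \<^term>\<open>p\<close> is the list of its arcs, so its length is the number of arcs;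
  \<^const>\<open>pre_digraph.apath\<close> demands that no vertex is repeated.
\<close>

definition joined_by_path :: "'a pair_pre_digraph \<Rightarrow> nat set \<Rightarrow> 'a \<Rightarrow> 'a \<Rightarrow> bool" where
  "joined_by_path H L x y \<longleftrightarrow>
     (\<exists>p. pre_digraph.apath (with_proj H) x p y \<and> length p \<in> L)"

end

theory Submission
  imports Defs
begin

text \<open>
  Blow up the closed walk \<open>x \<rightarrow> S \<rightarrow> A \<rightarrow> R \<rightarrow> B \<rightarrow> S \<rightarrow> y\<close>, where \<open>S\<close>, \<open>A\<close>, \<open>B\<close> have \<open>2c - 1\<close>
  vertices each and \<open>R\<close> has \<open>c\<close>, and place regular tournaments inside \<open>A\<close> and \<open>B\<close>. The only
  in-neighbours of \<open>y\<close> are \<open>x\<close> and \<open>S\<close>, so a path from \<open>x\<close> to \<open>y\<close> has length at most \<open>2\<close>,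
  unless it goes around through \<open>A\<close>, \<open>R\<close>, \<open>B\<close> back to \<open>S\<close> and then has length at least \<open>6\<close>.
  The arcs \<open>x \<rightarrow> y\<close>, \<open>A \<rightarrow> x\<close>, \<open>R \<rightarrow> x\<close>, \<open>y \<rightarrow> R\<close> and \<open>y \<rightarrow> B\<close> cannot be used by a longer
  path from \<open>x\<close> to \<open>y\<close>, but they bring all semidegrees up to \<open>2c\<close>. Taking \<open>c = 3C - 2\<close> gives order
  \<open>21C - 15\<close> and minimum semidegree \<open>N/3 - C + 1\<close>.
\<close>

definition S_part :: "nat \<Rightarrow> nat set" where "S_part c = {0..<2*c-1}"
definition A_part :: "nat \<Rightarrow> nat set" where "A_part c = {2*c-1..<4*c-2}"
definition B_part :: "nat \<Rightarrow> nat set" where "B_part c = {4*c-2..<6*c-3}"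
definition R_part :: "nat \<Rightarrow> nat set" where "R_part c = {6*c-3..<7*c-3}"
definition src :: "nat \<Rightarrow> nat" where "src c = 7*c-3"
definition snk :: "nat \<Rightarrow> nat" where "snk c = 7*c-2"

lemmas part_defs = S_part_def A_part_def B_part_def R_part_def src_def snk_def

text \<open>On \<open>2c - 1\<close> consecutive integers this is the rotational tournament: \<open>u\<close> beats the next
  \<open>c - 1\<close> integers in cyclic order.\<close>

definition beats :: "nat \<Rightarrow> nat \<Rightarrow> nat \<Rightarrow> bool" where
  "beats c u v \<longleftrightarrow> u < v \<and> v < u + c \<or> v + c \<le> u"

definition block_arc :: "nat \<Rightarrow> nat \<Rightarrow> nat \<Rightarrow> bool" where
  "block_arc c u v \<longleftrightarrow>
     u = src c \<and> (v \<in> S_part c \<or> v = snk c) \<or>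
     u \<in> S_part c \<and> (v \<in> A_part c \<or> v = snk c) \<or>
     u \<in> A_part c \<and> (v \<in> A_part c \<and> beats c u v \<or> v \<in> R_part c \<or> v = src c) \<or>
     u \<in> R_part c \<and> (v \<in> B_part c \<or> v = src c) \<or>
     u \<in> B_part c \<and> (v \<in> B_part c \<and> beats c u v \<or> v \<in> S_part c) \<or>
     u = snk c \<and> (v \<in> B_part c \<or> v \<in> R_part c)"

definition blowup :: "nat \<Rightarrow> nat pair_pre_digraph" where
  "blowup c = \<lparr>pverts = {0..<7*c-1}, parcs = {(u, v). block_arc c u v}\<rparr>"

section \<open>The blow-up is an oriented graph\<close>

lemma vertex_cases:
  assumes "c \<ge> 2" "v < 7*c-1"
  obtains "v \<in> S_part c" | "v \<in> A_part c" | "v \<in> B_part c" | "v \<in> R_part c" | "v = src c" | "v = snk c"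
proof -
  have "v \<in> S_part c \<or> v \<in> A_part c \<or> v \<in> B_part c \<or> v \<in> R_part c \<or> v = src c \<or> v = snk c"
  proof -
    \<comment> \<open>Writing \<open>c\<close> as \<open>k + 2\<close> removes the truncated
      subtractions from the interval bounds.\<close>
    obtain k where "c = k + 2" using assms(1) by (metis add.commute le_Suc_ex)
    then show ?thesis using assms(2) by (simp add: part_defs) linarith
  qed
  with that show thesis by blast
qed

lemma block_arc_bounded:
  assumes "c \<ge> 2" "block_arc c u v"
  shows "u < 7*c-1" "v < 7*c-1"
proof -
  have "S_part c \<subseteq> {..<7*c-1}" "A_part c \<subseteq> {..<7*c-1}" "B_part c \<subseteq> {..<7*c-1}"
    "R_part c \<subseteq> {..<7*c-1}" "src c \<in> {..<7*c-1}" "snk c \<in> {..<7*c-1}"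
    using assms(1) by (auto simp: part_defs)
  then have "u \<in> {..<7*c-1} \<and> v \<in> {..<7*c-1}"
    using assms(2) unfolding block_arc_def by blast
  then show "u < 7*c-1" "v < 7*c-1" by simp_all
qed

lemma parts_disjoint:
  assumes "c \<ge> 2"
  shows "S_part c \<inter> A_part c = {}" "S_part c \<inter> B_part c = {}" "S_part c \<inter> R_part c = {}"
    "A_part c \<inter> B_part c = {}" "A_part c \<inter> R_part c = {}" "B_part c \<inter> R_part c = {}"
    "src c \<notin> S_part c" "src c \<notin> A_part c" "src c \<notin> B_part c" "src c \<notin> R_part c"
    "snk c \<notin> S_part c" "snk c \<notin> A_part c" "snk c \<notin> B_part c" "snk c \<notin> R_part c"
    "src c \<noteq> snk c"
  using assms unfolding part_defs by auto

text \<open>No two different parts send arcs to each other in both directions. Inside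
  \<open>A_part\<close> and \<open>B_part\<close> the larger of two integers is beaten when their
  distance is below \<open>c\<close> and beats otherwise, never both.\<close>

lemma block_arc_asym:
  assumes "c \<ge> 2" "block_arc c u v"
  shows "\<not> block_arc c v u"
proof -
  note d = parts_disjoint[OF assms(1)]
  have b: "\<not> (beats c u v \<and> beats c v u)" using assms(1) by (auto simp: beats_def)
  show ?thesis using assms(1) block_arc_bounded(1)[OF assms]
    by (cases rule: vertex_cases) (use assms(2) d b in \<open>auto simp: block_arc_def\<close>)
qed

lemma oriented_graph_blowup:
  assumes "c \<ge> 2"
  shows "oriented_graph (blowup c)"
proof
  show "finite (parcs (blowup c))"
    by (rule finite_subset[of _ "{0..<7*c-1} \<times> {0..<7*c-1}"])
      (auto simp: blowup_def dest: block_arc_bounded[OF assms])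
\<comment> \<open>Asymmetry at a pair with equal ends also excludes loops.\<close>
qed (use assms in \<open>auto simp: blowup_def dest: block_arc_bounded block_arc_asym\<close>)

section \<open>Minimum semidegree\<close>

lemma out_degree_with_proj: "out_degree (with_proj G) v = card {w. (v, w) \<in> parcs G}"
proof -
  have "out_arcs (with_proj G) v = Pair v ` {w. (v, w) \<in> parcs G}" by auto
  then show ?thesis by (simp add: out_degree_def card_image inj_on_def)
qed

lemma in_degree_with_proj: "in_degree (with_proj G) v = card {u. (u, v) \<in> parcs G}"
proof -
  have "in_arcs (with_proj G) v = (\<lambda>u. (u, v)) ` {u. (u, v) \<in> parcs G}" by auto
  then show ?thesis by (simp add: in_degree_def card_image inj_on_def)
qed

text \<open>The first \<open>c\<close> vertices have their \<open>c - 1\<close> cyclic successors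
  directly above them. For a later \<open>v\<close> the successors wrap round:
  \<open>a + 2*c - 2 - v\<close> lie above \<open>v\<close> and \<open>v - c - a + 1\<close> at the
  start of the interval.\<close>

lemma card_beaten:
  assumes "c \<ge> 2" "v \<in> {a..<a+(2*c-1)}"
  shows "card {w \<in> {a..<a+(2*c-1)}. beats c v w} = c - 1"
proof (cases "v < a + c")
  case True
  then have "{w \<in> {a..<a+(2*c-1)}. beats c v w} = {v<..<v+c}"
    using assms by (auto simp: beats_def)
  then show ?thesis by simp
next
  case False
  then have "{w \<in> {a..<a+(2*c-1)}. beats c v w} = {v<..<a+(2*c-1)} \<union> {a..v-c}"
    using assms by (auto simp: beats_def)
  moreover have "{v<..<a+(2*c-1)} \<inter> {a..v-c} = {}" by auto
  ultimately show ?thesis using False assms by (simp add: card_Un_disjoint)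
qed

text \<open>In a tournament each of the other \<open>2*c - 2\<close> vertices either beats
  \<open>v\<close> or is beaten by it, and \<open>c - 1\<close> are beaten.\<close>

lemma card_beating:
  assumes "c \<ge> 2" "v \<in> {a..<a+(2*c-1)}"
  shows "card {u \<in> {a..<a+(2*c-1)}. beats c u v} = c - 1"
proof -
  let ?I = "{a..<a+(2*c-1)}"
  have split: "?I = {u \<in> ?I. beats c u v} \<union> {u \<in> ?I. beats c v u} \<union> {v}"
    using assms by (auto simp: beats_def)
  have "card ?I = card {u \<in> ?I. beats c u v} + card {u \<in> ?I. beats c v u} + 1"
    by (subst split, subst card_Un_disjoint, simp, simp, force simp: beats_def,
        subst card_Un_disjoint) (auto simp: beats_def)
  moreover have "card ?I = 2*c-1" by simp
  ultimately show ?thesis using card_beaten[OF assms] by linarith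
qed

text \<open>This bounds a degree from below by two disjoint sets of neighbours, without computing
  the whole neighbourhood.\<close>

lemma card_union_le:
  assumes "finite Z" "X \<subseteq> Z" "Y \<subseteq> Z" "X \<inter> Y = {}"
  shows "card X + card Y \<le> card Z"
  by (metis assms Un_least card_Un_disjoint card_mono finite_subset)

lemma card_parts:
  assumes "c \<ge> 2"
  shows "card (S_part c) = 2*c-1" "card (A_part c) = 2*c-1" "card (B_part c) = 2*c-1"
    "card (R_part c) = c"
    "finite (S_part c)" "finite (A_part c)" "finite (B_part c)" "finite (R_part c)"
  using assms unfolding part_defs by auto

lemma beats_parts:
  assumes "c \<ge> 2"
  shows "v \<in> A_part c \<Longrightarrow> card {w \<in> A_part c. beats c v w} = c - 1"
    "v \<in> A_part c \<Longrightarrow> card {u \<in> A_part c. beats c u v} = c - 1"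
    "v \<in> B_part c \<Longrightarrow> card {w \<in> B_part c. beats c v w} = c - 1"
    "v \<in> B_part c \<Longrightarrow> card {u \<in> B_part c. beats c u v} = c - 1"
proof -
  have A: "A_part c = {2*c-1..<2*c-1+(2*c-1)}" and B: "B_part c = {4*c-2..<4*c-2+(2*c-1)}"
    using assms unfolding part_defs by auto
  show "v \<in> A_part c \<Longrightarrow> card {w \<in> A_part c. beats c v w} = c - 1"
    "v \<in> A_part c \<Longrightarrow> card {u \<in> A_part c. beats c u v} = c - 1"
    "v \<in> B_part c \<Longrightarrow> card {w \<in> B_part c. beats c v w} = c - 1"
    "v \<in> B_part c \<Longrightarrow> card {u \<in> B_part c. beats c u v} = c - 1"
    unfolding A B using card_beaten[OF assms] card_beating[OF assms] by blast+
qed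

text \<open>The two sets exhibited have total size exactly \<open>2*c\<close>, except
  \<open>3*c - 2\<close> for \<open>B_part\<close> and \<open>3*c - 1\<close> for
  \<open>snk c\<close>; the former is where \<open>c \<ge> 2\<close> matters for the count.\<close>

lemma card_out_neighbours:
  assumes "c \<ge> 2" "v < 7*c-1"
  shows "2*c \<le> card {w. block_arc c v w}"
proof -
  note d = parts_disjoint[OF assms(1)] and k = card_parts[OF assms(1)]
    and b = beats_parts[OF assms(1)]
  have fin: "finite {w. block_arc c v w}"
    by (rule finite_subset[of _ "{0..<7*c-1}"]) (auto dest: block_arc_bounded[OF assms(1)])
  note le = card_union_le[OF fin]
  show ?thesis using assms
  proof (cases rule: vertex_cases)
    case 1
    have "card (A_part c) + card {snk c} \<le> card {w. block_arc c v w}"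
      by (rule le) (use 1 d in \<open>auto simp: block_arc_def\<close>)
    then show ?thesis using k assms by simp
  next
    case 2
    have "card {w \<in> A_part c. beats c v w} + card (R_part c \<union> {src c}) \<le> card {w. block_arc c v w}"
      by (rule le) (use 2 d in \<open>auto simp: block_arc_def\<close>)
    then show ?thesis using k b(1)[OF 2] d assms by simp
  next
    case 3
    have "card {w \<in> B_part c. beats c v w} + card (S_part c) \<le> card {w. block_arc c v w}"
      by (rule le) (use 3 d in \<open>auto simp: block_arc_def\<close>)
    then show ?thesis using k b(3)[OF 3] assms by simp
  next
    case 4
    have "card (B_part c) + card {src c} \<le> card {w. block_arc c v w}"
      by (rule le) (use 4 d in \<open>auto simp: block_arc_def\<close>)
    then show ?thesis using k assms by simp
  next
    case 5
    have "card (S_part c) + card {snk c} \<le> card {w. block_arc c v w}"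
      by (rule le) (use 5 d in \<open>auto simp: block_arc_def\<close>)
    then show ?thesis using k assms by simp
  next
    case 6
    have "card (B_part c) + card (R_part c) \<le> card {w. block_arc c v w}"
      by (rule le) (use 6 d in \<open>auto simp: block_arc_def\<close>)
    then show ?thesis using k assms by simp
  qed
qed

text \<open>Reversing all arcs while exchanging \<open>A_part\<close> with \<open>B_part\<close> and
  \<open>src\<close> with \<open>snk\<close> preserves the pattern of arcs between parts, so the
  counts mirror those for out-neighbours.\<close>

lemma card_in_neighbours:
  assumes "c \<ge> 2" "v < 7*c-1"
  shows "2*c \<le> card {u. block_arc c u v}"
proof -
  note d = parts_disjoint[OF assms(1)] and k = card_parts[OF assms(1)]
    and b = beats_parts[OF assms(1)]
  have fin: "finite {u. block_arc c u v}"
    by (rule finite_subset[of _ "{0..<7*c-1}"]) (auto dest: block_arc_bounded[OF assms(1)])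
  note le = card_union_le[OF fin]
  show ?thesis using assms
  proof (cases rule: vertex_cases)
    case 1
    have "card (B_part c) + card {src c} \<le> card {u. block_arc c u v}"
      by (rule le) (use 1 d in \<open>auto simp: block_arc_def\<close>)
    then show ?thesis using k assms by simp
  next
    case 2
    have "card {u \<in> A_part c. beats c u v} + card (S_part c) \<le> card {u. block_arc c u v}"
      by (rule le) (use 2 d in \<open>auto simp: block_arc_def\<close>)
    then show ?thesis using k b(2)[OF 2] assms by simp
  next
    case 3
    have "card {u \<in> B_part c. beats c u v} + card (R_part c \<union> {snk c}) \<le> card {u. block_arc c u v}"
      by (rule le) (use 3 d in \<open>auto simp: block_arc_def\<close>)
    then show ?thesis using k b(4)[OF 3] d assms by simp
  next
    case 4
    have "card (A_part c) + card {snk c} \<le> card {u. block_arc c u v}"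
      by (rule le) (use 4 d in \<open>auto simp: block_arc_def\<close>)
    then show ?thesis using k assms by simp
  next
    case 5
    have "card (A_part c) + card (R_part c) \<le> card {u. block_arc c u v}"
      by (rule le) (use 5 d in \<open>auto simp: block_arc_def\<close>)
    then show ?thesis using k assms by simp
  next
    case 6
    have "card (S_part c) + card {src c} \<le> card {u. block_arc c u v}"
      by (rule le) (use 6 d in \<open>auto simp: block_arc_def\<close>)
    then show ?thesis using k assms by simp
  qed
qed

lemma min_semidegree_blowup:
  assumes "c \<ge> 2"
  shows "min_semidegree (blowup c) = 2*c"
proof -
  let ?f = "\<lambda>v. min (card {w. block_arc c v w}) (card {u. block_arc c u v})"
  have src: "src c < 7*c-1" using assms by (simp add: src_def)
  note d = parts_disjoint[OF assms]
  \<comment> \<open>The lower bound is attained by the out-degree of \<open>src c\<close>.\<close>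
  have "{w. block_arc c (src c) w} = insert (snk c) (S_part c)"
    using d by (auto simp: block_arc_def)
  then have "card {w. block_arc c (src c) w} = 2*c"
    using card_parts[OF assms] d assms by simp
  then have "?f (src c) = 2*c"
    using card_in_neighbours[OF assms src] by simp
  then have mem: "2*c \<in> ?f ` {0..<7*c-1}"
    using src by (intro image_eqI[where x = "src c"]) simp_all
  have "Min (?f ` {0..<7*c-1}) = 2*c"
  proof (rule Min_eqI[OF _ _ mem])
    fix k assume "k \<in> ?f ` {0..<7*c-1}"
    then obtain v where "v < 7*c-1" "k = ?f v" by auto
    then show "2*c \<le> k"
      using card_in_neighbours[OF assms] card_out_neighbours[OF assms] by simp
  qed simp
  then show ?thesis
    by (simp add: min_semidegree_def blowup_def out_degree_with_proj in_degree_with_proj)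
qed

section \<open>Excluding paths of length 3, 4 and 5\<close>

lemma not_joined_blowup:
  assumes "c \<ge> 2"
  shows "\<not> joined_by_path (blowup c) {3, 4, 5} (src c) (snk c)"
proof
  note d = parts_disjoint[OF assms]
  interpret oriented_graph "blowup c" by (rule oriented_graph_blowup[OF assms])
  assume "joined_by_path (blowup c) {3, 4, 5} (src c) (snk c)"
  then obtain p where p: "apath (src c) p (snk c)" "length p \<in> {3, 4, 5}"
    unfolding joined_by_path_def by blast
  \<comment> \<open>\<open>S\<close>, \<open>A\<close>, \<open>AR\<close> and \<open>ARB\<close>
    successively confine the first four vertices after \<open>src c\<close>. For lengths 3, 4 and 5
    the vertex before \<open>snk c\<close> is the second, third or fourth of these, and
    \<open>last\<close> rules it out. Simplicity of the path supplies the side conditions that inner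
    vertices avoid both ends.\<close>
  have S: "v \<in> S_part c" if "block_arc c (src c) v" "v \<noteq> snk c" for v
    using that d by (auto simp: block_arc_def)
  have A: "v \<in> A_part c" if "u \<in> S_part c" "block_arc c u v" "v \<noteq> snk c" for u v
    using that d by (auto simp: block_arc_def)
  have AR: "v \<in> A_part c \<union> R_part c" if "u \<in> A_part c" "block_arc c u v" "v \<noteq> src c" for u v
    using that d by (auto simp: block_arc_def)
  have ARB: "v \<in> A_part c \<union> R_part c \<union> B_part c"
    if "u \<in> A_part c \<union> R_part c" "block_arc c u v" "v \<noteq> src c" for u v
    using that d by (auto simp: block_arc_def)
  have last: "u \<notin> A_part c \<union> R_part c \<union> B_part c" if "block_arc c u (snk c)" for u
    using that d by (auto simp: block_arc_def)
  have arcs: "(u, v) \<in> parcs (blowup c) \<longleftrightarrow> block_arc c u v" for u v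
    by (simp add: blowup_def)
  from p(2) consider "length p = 3" | "length p = 4" | "length p = 5" by blast
  then show False
  proof cases
    case 1
    then obtain v1 v2 where "block_arc c (src c) v1" "block_arc c v1 v2" "block_arc c v2 (snk c)"
      "v1 \<noteq> snk c" "v2 \<noteq> snk c"
      using p(1) by (auto simp: numeral_eq_Suc length_Suc_conv apath_Cons_iff apath_Nil_iff arcs)
    then show False using S A last by blast
  next
    case 2
    then obtain v1 v2 v3 where "block_arc c (src c) v1" "block_arc c v1 v2" "block_arc c v2 v3"
      "block_arc c v3 (snk c)"
      "v1 \<noteq> snk c" "v2 \<noteq> snk c" "v3 \<noteq> src c"
      using p(1) by (auto simp: numeral_eq_Suc length_Suc_conv apath_Cons_iff apath_Nil_iff arcs)
    then show False using S A AR last by blast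
  next
    case 3
    then obtain v1 v2 v3 v4 where "block_arc c (src c) v1" "block_arc c v1 v2" "block_arc c v2 v3"
      "block_arc c v3 v4" "block_arc c v4 (snk c)" "v1 \<noteq> snk c" "v2 \<noteq> snk c" "v3 \<noteq> src c" "v4 \<noteq> src c"
      using p(1) by (auto simp: numeral_eq_Suc length_Suc_conv apath_Cons_iff apath_Nil_iff arcs)
    then show False using S A AR ARB last by meson
  qed
qed

lemma blowup_props:
  assumes "c \<ge> 2"
  shows "oriented_graph (blowup c)" "card (pverts (blowup c)) = 7*c-1"
    "min_semidegree (blowup c) = 2*c"
    "src c \<in> pverts (blowup c)" "snk c \<in> pverts (blowup c)" "src c \<noteq> snk c"
    "\<not> joined_by_path (blowup c) {3, 4, 5} (src c) (snk c)"
proof -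
  show "card (pverts (blowup c)) = 7*c-1" by (simp add: blowup_def)
  show "src c \<in> pverts (blowup c)" "snk c \<in> pverts (blowup c)" "src c \<noteq> snk c"
    using assms by (simp_all add: blowup_def src_def snk_def)
qed (fact oriented_graph_blowup[OF assms] min_semidegree_blowup[OF assms] not_joined_blowup[OF assms])+

section \<open>The three claims\<close>

theorem proposition2p4:
  shows
    "(\<forall>c::nat. c \<ge> 2 \<longrightarrow>
        (\<exists>(H :: nat pair_pre_digraph) x y.
           oriented_graph H \<and>
           card (pverts H) = 7 * c - 1 \<and>
           min_semidegree H = 2 * c \<and>
           7 * min_semidegree H = 2 * card (pverts H) + 2 \<and>
           x \<in> pverts H \<and> y \<in> pverts H \<and> x \<noteq> y \<and>
           \<not> joined_by_path H {3, 4, 5} x y))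
     \<and>
     \<not> (\<forall>H :: nat pair_pre_digraph.
           oriented_graph H \<and>
           min_semidegree H \<ge> 3 \<and>
           7 * min_semidegree H \<ge> 2 * card (pverts H) + 2 \<longrightarrow>
           (\<forall>x \<in> pverts H. \<forall>y \<in> pverts H. x \<noteq> y \<longrightarrow> joined_by_path H {3, 4, 5} x y))
     \<and>
     \<not> (\<exists>\<gamma> K :: real. \<gamma> < 21 \<and>
           (\<forall>C::nat. C > 0 \<longrightarrow>
              (\<forall>H :: nat pair_pre_digraph.
                 oriented_graph H \<and>
                 real (card (pverts H)) \<ge> \<gamma> * real C + K \<and>
                 real (min_semidegree H) \<ge> real (card (pverts H)) / 3 - real C + 1 \<longrightarrow>
                 (\<forall>x \<in> pverts H. \<forall>y \<in> pverts H. x \<noteq> y \<longrightarrow> joined_by_path H {3, 4, 5} x y))))"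
proof (intro conjI)
  show "\<forall>c::nat. c \<ge> 2 \<longrightarrow>
        (\<exists>(H :: nat pair_pre_digraph) x y.
           oriented_graph H \<and>
           card (pverts H) = 7 * c - 1 \<and>
           min_semidegree H = 2 * c \<and>
           7 * min_semidegree H = 2 * card (pverts H) + 2 \<and>
           x \<in> pverts H \<and> y \<in> pverts H \<and> x \<noteq> y \<and>
           \<not> joined_by_path H {3, 4, 5} x y)"
  proof (intro allI impI)
    fix c :: nat assume c: "c \<ge> 2"
    have "7 * min_semidegree (blowup c) = 2 * card (pverts (blowup c)) + 2"
      using blowup_props(2,3)[OF c] c by simp
    with blowup_props[OF c] show "\<exists>(H :: nat pair_pre_digraph) x y.
           oriented_graph H \<and>
           card (pverts H) = 7 * c - 1 \<and>
           min_semidegree H = 2 * c \<and>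
           7 * min_semidegree H = 2 * card (pverts H) + 2 \<and>
           x \<in> pverts H \<and> y \<in> pverts H \<and> x \<noteq> y \<and>
           \<not> joined_by_path H {3, 4, 5} x y"
      by blast
  qed
next
  show "\<not> (\<forall>H :: nat pair_pre_digraph.
           oriented_graph H \<and>
           min_semidegree H \<ge> 3 \<and>
           7 * min_semidegree H \<ge> 2 * card (pverts H) + 2 \<longrightarrow>
           (\<forall>x \<in> pverts H. \<forall>y \<in> pverts H. x \<noteq> y \<longrightarrow> joined_by_path H {3, 4, 5} x y))"
  proof
    assume *: "\<forall>H :: nat pair_pre_digraph.
           oriented_graph H \<and>
           min_semidegree H \<ge> 3 \<and>
           7 * min_semidegree H \<ge> 2 * card (pverts H) + 2 \<longrightarrow>
           (\<forall>x \<in> pverts H. \<forall>y \<in> pverts H. x \<noteq> y \<longrightarrow> joined_by_path H {3, 4, 5} x y)"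
    \<comment> \<open>Here the order is 13 and the semidegree 4, and 7 * 4 = 2 * 13 + 2.\<close>
    have "min_semidegree (blowup 2) \<ge> 3"
      "7 * min_semidegree (blowup 2) \<ge> 2 * card (pverts (blowup 2)) + 2"
      using blowup_props(2,3)[of 2] by auto
    with * blowup_props[of 2] show False by blast
  qed
next
  show "\<not> (\<exists>\<gamma> K :: real. \<gamma> < 21 \<and>
           (\<forall>C::nat. C > 0 \<longrightarrow>
              (\<forall>H :: nat pair_pre_digraph.
                 oriented_graph H \<and>
                 real (card (pverts H)) \<ge> \<gamma> * real C + K \<and>
                 real (min_semidegree H) \<ge> real (card (pverts H)) / 3 - real C + 1 \<longrightarrow>
                 (\<forall>x \<in> pverts H. \<forall>y \<in> pverts H. x \<noteq> y \<longrightarrow> joined_by_path H {3, 4, 5} x y))))"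
  proof (intro notI, elim exE conjE)
    fix \<gamma> K :: real
    assume \<gamma>: "\<gamma> < 21" and *: "\<forall>C::nat. C > 0 \<longrightarrow>
              (\<forall>H :: nat pair_pre_digraph.
                 oriented_graph H \<and>
                 real (card (pverts H)) \<ge> \<gamma> * real C + K \<and>
                 real (min_semidegree H) \<ge> real (card (pverts H)) / 3 - real C + 1 \<longrightarrow>
                 (\<forall>x \<in> pverts H. \<forall>y \<in> pverts H. x \<noteq> y \<longrightarrow> joined_by_path H {3, 4, 5} x y))"
    \<comment> \<open>As \<gamma> < 21, the required order bound 21 * C - 15 \<ge> \<gamma> * C + K
      amounts to this lower bound on \<open>C\<close>.\<close>
    obtain n :: nat where n: "(K + 15) / (21 - \<gamma>) \<le> real n" using real_arch_simple by blast
    \<comment> \<open>\<open>C = 1\<close> would give \<open>c = 1\<close>, too small for the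
      construction.\<close>
    define C where "C = n + 2"
    \<comment> \<open>The degree condition 2 * c \<ge> (7 * c - 1) / 3 - C + 1 is equivalent to c
      \<le> 3 * C - 2, so this is the largest choice and gives equality.\<close>
    define c where "c = 3 * C - 2"
    have c: "c \<ge> 2" by (simp add: c_def C_def)
    have "(K + 15) / (21 - \<gamma>) \<le> real C" using n by (simp add: C_def)
    then have "K + 15 \<le> real C * (21 - \<gamma>)" using \<gamma> by (simp add: pos_divide_le_eq)
    moreover have N: "real (card (pverts (blowup c))) = 21 * real C - 15"
      unfolding blowup_props(2)[OF c] by (simp add: c_def C_def)
    moreover have "real (min_semidegree (blowup c)) = 6 * real C - 4"
      unfolding blowup_props(3)[OF c] by (simp add: c_def C_def)
    ultimately have "real (card (pverts (blowup c))) \<ge> \<gamma> * real C + K"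
      "real (min_semidegree (blowup c)) \<ge> real (card (pverts (blowup c))) / 3 - real C + 1"
      by (simp_all add: algebra_simps)
    moreover have "C > 0" by (simp add: C_def)
    ultimately show False using * blowup_props[OF c] by blast
  qed
qed

end
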